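(* Let $(N,\langle\cdot,\cdot\rangle)$ be a Lie group equipped with a left-invariant metric, with Lie algebra $\mathfrak n$, and let $f:TN\to\mathbb R$ be a smooth function with gradient $\mathrm{grad}_{(p,Y)}f=(U,V)$. Then: (i) the Hamiltonian vector field of $f$ is given by $$X_f(p,Y)=(V,\ \mathrm{ad}^t(V)(Y)-U),$$ where $\mathrm{ad}^t(V)$ denotes the transpose of $\mathrm{ad}(V)$ with respect to the metric on $\mathfrak n$; (ii) the Poisson bracket of a pair of smooth functions $f,g:TN\to\mathbb R$ with $\mathrm{grad}_{(p,Y)}f=(U,V)$ and $\mathrm{grad}_{(p,Y)}g=(U',V')$ is given by $$\{f,g\}(p,Y)=-\Omega_{(p,Y)}(\mathrm A\,\mathrm{grad} f,\mathrm A\,\mathrm{grad} g)=\langle V',U\rangle-\langle V,U'\rangle-\langle Y,[V,V']\rangle,$$ where $\mathrm A(U,V)=(V,U)$.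
   Context: $TN$ is identified with $N\times\mathfrak n$, where $(p,Y)$ stands for $dL_p(Y)$, and $T_{(p,Y)}(TN)$ with $\mathfrak n\times\mathfrak n$, where $(U,V)$ is the initial velocity of $t\mapsto(p\exp(tU),Y+tV)$. $TN$ carries the product metric $\langle(U,V),(U',V')\rangle=\langle U,U'\rangle+\langle V,V'\rangle$, and $\mathrm{grad}f$ is defined by $df_{(p,Y)}(\xi)=\langle\mathrm{grad}_{(p,Y)}f,\xi\rangle$; its components $U,V\in\mathfrak n$ depend on $(p,Y)$. The canonical symplectic form on $TN$ is $\Omega=-d\Theta$ with $\Theta_{(p,Y)}(U,V)=\langle Y,U\rangle$, explicitly $\Omega_{(p,Y)}((U,V),(U',V'))=\langle U,V'\rangle-\langle V,U'\rangle+\langle Y,[U,U']\rangle$. The Hamiltonian vector field $X_f$ is defined by $df=\Omega(X_f,\cdot)$, and the Poisson bracket by $\{f,g\}=\Omega(X_f,X_g)$. *)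

theory Defs
  imports "HOL-Analysis.Analysis" "HOL-Algebra.Group"
begin

text \<open>
  Iterated directional derivatives. On an open subset of a Euclidean space
  \<open>Ck_on k f S\<close> says that all partial derivatives of order at most \<open>k\<close> exist and are
  continuous.
\<close>

primrec Ck_on :: "nat \<Rightarrow> ('x::euclidean_space \<Rightarrow> 'y::real_normed_vector) \<Rightarrow> 'x set \<Rightarrow> bool" where
  "Ck_on 0 f S \<longleftrightarrow> continuous_on S f"
| "Ck_on (Suc k) f S \<longleftrightarrow>
     f differentiable_on S \<and> (\<forall>v. Ck_on k (\<lambda>x. frechet_derivative f (at x) v) S)"

definition smooth_on :: "'x::euclidean_space set \<Rightarrow> ('x \<Rightarrow> 'y::real_normed_vector) \<Rightarrow> bool" where
  "smooth_on S f \<longleftrightarrow> (\<forall>k. Ck_on k f S)"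

text \<open>A chart is a pair of its domain and its coordinate map; a manifold is a topology together
  with an atlas (which need not be maximal).\<close>

type_synonym ('a, 'e) chart = "'a set \<times> ('a \<Rightarrow> 'e)"
type_synonym ('a, 'e) manifold = "'a topology \<times> ('a, 'e) chart set"

definition chart_inv :: "('a, 'e) chart \<Rightarrow> 'e \<Rightarrow> 'a" where
  "chart_inv c = inv_into (fst c) (snd c)"

definition smooth_manifold :: "('a, 'e::euclidean_space) manifold \<Rightarrow> bool" where
  "smooth_manifold M \<longleftrightarrow>
     Hausdorff_space (fst M) \<and> second_countable (fst M) \<and>
     (\<Union>c\<in>snd M. fst c) = topspace (fst M) \<and>
     (\<forall>c\<in>snd M. openin (fst M) (fst c) \<and> open (snd c ` fst c) \<and>
        homeomorphic_map (subtopology (fst M) (fst c)) (top_of_set (snd c ` fst c)) (snd c)) \<and>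
     (\<forall>c\<in>snd M. \<forall>d\<in>snd M. smooth_on (snd c ` (fst c \<inter> fst d)) (snd d \<circ> chart_inv c))"

definition euclid_manifold :: "('e::euclidean_space, 'e) manifold" where
  "euclid_manifold = (euclidean, {(UNIV, id)})"

definition prod_manifold ::
  "('a, 'e) manifold \<Rightarrow> ('b, 'f) manifold \<Rightarrow> ('a \<times> 'b, 'e \<times> 'f) manifold" where
  "prod_manifold M M' =
     (prod_topology (fst M) (fst M'),
      {(fst c \<times> fst d, map_prod (snd c) (snd d)) |c d. c \<in> snd M \<and> d \<in> snd M'})"

definition smooth_map ::
  "('a, 'e::euclidean_space) manifold \<Rightarrow> ('b, 'f::euclidean_space) manifold \<Rightarrow> ('a \<Rightarrow> 'b) \<Rightarrow> bool" where
  "smooth_map M M' F \<longleftrightarrow>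
     continuous_map (fst M) (fst M') F \<and>
     (\<forall>c\<in>snd M. \<forall>d\<in>snd M'. smooth_on (snd c ` (fst c \<inter> F -` fst d)) (snd d \<circ> F \<circ> chart_inv c))"

text \<open>
  A preferred chart is chosen around each point \<open>p\<close>, and a tangent vector at \<open>p\<close> is represented
  by its coordinate vector in that chart, so that every tangent space is a copy of the model
  space \<open>'e\<close>. The functions \<open>to_chart\<close> and \<open>from_chart\<close> convert between this
  representation and the coordinates in an arbitrary chart around \<open>p\<close>.
\<close>

definition chart_at :: "('a, 'e) manifold \<Rightarrow> 'a \<Rightarrow> ('a, 'e) chart" where
  "chart_at M p = (SOME c. c \<in> snd M \<and> p \<in> fst c)"

definition tangent_map ::
  "('a, 'e::euclidean_space) manifold \<Rightarrow> ('b, 'f::euclidean_space) manifold \<Rightarrow>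
   ('a \<Rightarrow> 'b) \<Rightarrow> 'a \<Rightarrow> 'e \<Rightarrow> 'f" where
  "tangent_map M M' F p v =
     frechet_derivative (snd (chart_at M' (F p)) \<circ> F \<circ> chart_inv (chart_at M p))
       (at (snd (chart_at M p) p)) v"

definition to_chart ::
  "('a, 'e::euclidean_space) manifold \<Rightarrow> ('a, 'e) chart \<Rightarrow> 'a \<Rightarrow> 'e \<Rightarrow> 'e" where
  "to_chart M c p v =
     frechet_derivative (snd c \<circ> chart_inv (chart_at M p)) (at (snd (chart_at M p) p)) v"

definition from_chart ::
  "('a, 'e::euclidean_space) manifold \<Rightarrow> ('a, 'e) chart \<Rightarrow> 'a \<Rightarrow> 'e \<Rightarrow> 'e" where
  "from_chart M c p v =
     frechet_derivative (snd (chart_at M p) \<circ> chart_inv c) (at (snd c p)) v"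

definition field_in_chart ::
  "('a, 'e::euclidean_space) manifold \<Rightarrow> ('a, 'e) chart \<Rightarrow> ('a \<Rightarrow> 'e) \<Rightarrow> 'e \<Rightarrow> 'e" where
  "field_in_chart M c X x = to_chart M c (chart_inv c x) (X (chart_inv c x))"

text \<open>Commutator of vector fields: in coordinates, \<open>[X, Y] = DY(X) - DX(Y)\<close>, that is,
  \<open>[X, Y] F = X (Y F) - Y (X F)\<close>.\<close>

definition field_bracket ::
  "('a, 'e::euclidean_space) manifold \<Rightarrow> ('a \<Rightarrow> 'e) \<Rightarrow> ('a \<Rightarrow> 'e) \<Rightarrow> 'a \<Rightarrow> 'e" where
  "field_bracket M X Y p =
     (let c = chart_at M p; x = snd c p; X' = field_in_chart M c X; Y' = field_in_chart M c Y
      in frechet_derivative Y' (at x) (X' x) - frechet_derivative X' (at x) (Y' x))"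

definition riemannian_metric ::
  "('a, 'e::euclidean_space) manifold \<Rightarrow> ('a \<Rightarrow> 'e \<Rightarrow> 'e \<Rightarrow> real) \<Rightarrow> bool" where
  "riemannian_metric M g \<longleftrightarrow>
     (\<forall>p\<in>topspace (fst M). bilinear (g p) \<and> (\<forall>u v. g p u v = g p v u) \<and>
        (\<forall>u. u \<noteq> 0 \<longrightarrow> g p u u > 0)) \<and>
     (\<forall>c\<in>snd M. \<forall>u v. smooth_on (snd c ` fst c)
        (\<lambda>x. let p = chart_inv c x in g p (from_chart M c p u) (from_chart M c p v)))"

record ('a, 'e) lie_group = "'a monoid" +
  mfd :: "('a, 'e) manifold"

definition is_lie_group :: "('a, 'e::euclidean_space) lie_group \<Rightarrow> bool" where
  "is_lie_group N \<longleftrightarrow>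
     group N \<and> smooth_manifold (mfd N) \<and> topspace (fst (mfd N)) = carrier N \<and>
     smooth_map (prod_manifold (mfd N) (mfd N)) (mfd N) (\<lambda>(p, q). p \<otimes>\<^bsub>N\<^esub> q) \<and>
     smooth_map (mfd N) (mfd N) (\<lambda>p. inv\<^bsub>N\<^esub> p)"

definition dL :: "('a, 'e::euclidean_space) lie_group \<Rightarrow> 'a \<Rightarrow> 'a \<Rightarrow> 'e \<Rightarrow> 'e" where
  "dL N p q = tangent_map (mfd N) (mfd N) (\<lambda>r. p \<otimes>\<^bsub>N\<^esub> r) q"

definition left_invariant_metric ::
  "('a, 'e::euclidean_space) lie_group \<Rightarrow> ('a \<Rightarrow> 'e \<Rightarrow> 'e \<Rightarrow> real) \<Rightarrow> bool" where
  "left_invariant_metric N g \<longleftrightarrow>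
     riemannian_metric (mfd N) g \<and>
     (\<forall>p\<in>carrier N. \<forall>q\<in>carrier N. \<forall>u v.
        g (p \<otimes>\<^bsub>N\<^esub> q) (dL N p q u) (dL N p q v) = g q u v)"

text \<open>The Lie algebra of \<open>N\<close> is the tangent space at the identity; its bracket is the commutator
  of left-invariant vector fields.\<close>

definition left_invariant_field ::
  "('a, 'e::euclidean_space) lie_group \<Rightarrow> 'e \<Rightarrow> 'a \<Rightarrow> 'e" where
  "left_invariant_field N U p = dL N p \<one>\<^bsub>N\<^esub> U"

definition lie_bracket :: "('a, 'e::euclidean_space) lie_group \<Rightarrow> 'e \<Rightarrow> 'e \<Rightarrow> 'e" where
  "lie_bracket N U V =
     field_bracket (mfd N) (left_invariant_field N U) (left_invariant_field N V) \<one>\<^bsub>N\<^esub>"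

definition one_param_subgroup ::
  "('a, 'e::euclidean_space) lie_group \<Rightarrow> 'e \<Rightarrow> (real \<Rightarrow> 'a) \<Rightarrow> bool" where
  "one_param_subgroup N U \<gamma> \<longleftrightarrow>
     smooth_map euclid_manifold (mfd N) \<gamma> \<and> (\<forall>s t. \<gamma> (s + t) = \<gamma> s \<otimes>\<^bsub>N\<^esub> \<gamma> t) \<and>
     tangent_map euclid_manifold (mfd N) \<gamma> 0 1 = U"

definition lie_exp :: "('a, 'e::euclidean_space) lie_group \<Rightarrow> 'e \<Rightarrow> 'a" where
  "lie_exp N U = (THE \<gamma>. one_param_subgroup N U \<gamma>) 1"

definition lie_inner :: "('a, 'e) lie_group \<Rightarrow> ('a \<Rightarrow> 'e \<Rightarrow> 'e \<Rightarrow> real) \<Rightarrow> 'e \<Rightarrow> 'e \<Rightarrow> real" where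
  "lie_inner N g = g \<one>\<^bsub>N\<^esub>"

text \<open>Compare \<^const>\<open>adjoint\<close>, which is tied to the inner product of the type.\<close>

definition transpose_wrt :: "('e \<Rightarrow> 'e \<Rightarrow> real) \<Rightarrow> ('e \<Rightarrow> 'e) \<Rightarrow> 'e \<Rightarrow> 'e" where
  "transpose_wrt h L = (SOME L'. \<forall>x y. h (L x) y = h x (L' y))"

definition ad :: "('a, 'e::euclidean_space) lie_group \<Rightarrow> 'e \<Rightarrow> 'e \<Rightarrow> 'e" where
  "ad N U V = lie_bracket N U V"

definition ad_transpose ::
  "('a, 'e::euclidean_space) lie_group \<Rightarrow> ('a \<Rightarrow> 'e \<Rightarrow> 'e \<Rightarrow> real) \<Rightarrow> 'e \<Rightarrow> 'e \<Rightarrow> 'e" where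
  "ad_transpose N g V = transpose_wrt (lie_inner N g) (ad N V)"

text \<open>
  The tangent bundle is identified with the product of \<open>N\<close> and its Lie algebra: \<open>(p, Y)\<close> stands
  for the tangent vector \<open>dL N p \<one> Y\<close> at \<open>p\<close>. A tangent vector to the bundle at \<open>(p, Y)\<close> is a
  pair \<open>(U, V)\<close>, the initial velocity of the curve \<open>(p exp(tU), Y + tV)\<close>.
\<close>

definition smooth_on_TN ::
  "('a, 'e::euclidean_space) lie_group \<Rightarrow> ('a \<times> 'e \<Rightarrow> real) \<Rightarrow> bool" where
  "smooth_on_TN N f \<longleftrightarrow> smooth_map (prod_manifold (mfd N) euclid_manifold) euclid_manifold f"

definition differential ::
  "('a, 'e::euclidean_space) lie_group \<Rightarrow> ('a \<times> 'e \<Rightarrow> real) \<Rightarrow> 'a \<times> 'e \<Rightarrow> 'e \<times> 'e \<Rightarrow> real" where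
  "differential N f = (\<lambda>(p, Y) (U, V).
     deriv (\<lambda>t. f (p \<otimes>\<^bsub>N\<^esub> lie_exp N (t *\<^sub>R U), Y + t *\<^sub>R V)) 0)"

definition TN_metric ::
  "('a, 'e) lie_group \<Rightarrow> ('a \<Rightarrow> 'e \<Rightarrow> 'e \<Rightarrow> real) \<Rightarrow> 'e \<times> 'e \<Rightarrow> 'e \<times> 'e \<Rightarrow> real" where
  "TN_metric N g = (\<lambda>(U, V) (U', V'). lie_inner N g U U' + lie_inner N g V V')"

definition has_gradient ::
  "('a, 'e::euclidean_space) lie_group \<Rightarrow> ('a \<Rightarrow> 'e \<Rightarrow> 'e \<Rightarrow> real) \<Rightarrow>
   ('a \<times> 'e \<Rightarrow> real) \<Rightarrow> 'a \<times> 'e \<Rightarrow> 'e \<times> 'e \<Rightarrow> bool" where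
  "has_gradient N g f z G \<longleftrightarrow> (\<forall>\<xi>. differential N f z \<xi> = TN_metric N g G \<xi>)"

definition canonical_form ::
  "('a, 'e) lie_group \<Rightarrow> ('a \<Rightarrow> 'e \<Rightarrow> 'e \<Rightarrow> real) \<Rightarrow> 'a \<times> 'e \<Rightarrow> 'e \<times> 'e \<Rightarrow> real" where
  "canonical_form N g = (\<lambda>(p, Y) (U, V). lie_inner N g Y U)"

text \<open>
  Exterior derivative of a one-form by Cartan's formula
  \<open>d\<theta>(\<xi>, \<eta>) = \<xi>(\<theta>(\<eta>)) - \<eta>(\<theta>(\<xi>)) - \<theta>([\<xi>, \<eta>])\<close>, where tangent vectors at a point are extended to
  vector fields that are constant in the left trivialization. The commutator of the constant
  fields \<open>(U, V)\<close> and \<open>(U', V')\<close> is the constant field \<open>([U, U'], 0)\<close>, the bracket in the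
  Lie algebra of the product of \<open>N\<close> with a vector group.
\<close>

definition ext_deriv ::
  "('a, 'e::euclidean_space) lie_group \<Rightarrow> ('a \<times> 'e \<Rightarrow> 'e \<times> 'e \<Rightarrow> real) \<Rightarrow>
   'a \<times> 'e \<Rightarrow> 'e \<times> 'e \<Rightarrow> 'e \<times> 'e \<Rightarrow> real" where
  "ext_deriv N \<theta> z \<xi> \<eta> =
     differential N (\<lambda>w. \<theta> w \<eta>) z \<xi> - differential N (\<lambda>w. \<theta> w \<xi>) z \<eta>
     - \<theta> z (lie_bracket N (fst \<xi>) (fst \<eta>), 0)"

definition symplectic_form ::
  "('a, 'e::euclidean_space) lie_group \<Rightarrow> ('a \<Rightarrow> 'e \<Rightarrow> 'e \<Rightarrow> real) \<Rightarrow>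
   'a \<times> 'e \<Rightarrow> 'e \<times> 'e \<Rightarrow> 'e \<times> 'e \<Rightarrow> real" where
  "symplectic_form N g z \<xi> \<eta> = - ext_deriv N (canonical_form N g) z \<xi> \<eta>"

definition hamiltonian_field ::
  "('a, 'e::euclidean_space) lie_group \<Rightarrow> ('a \<Rightarrow> 'e \<Rightarrow> 'e \<Rightarrow> real) \<Rightarrow>
   ('a \<times> 'e \<Rightarrow> real) \<Rightarrow> 'a \<times> 'e \<Rightarrow> 'e \<times> 'e" where
  "hamiltonian_field N g f z =
     (THE X. \<forall>\<xi>. differential N f z \<xi> = symplectic_form N g z X \<xi>)"

definition poisson_bracket ::
  "('a, 'e::euclidean_space) lie_group \<Rightarrow> ('a \<Rightarrow> 'e \<Rightarrow> 'e \<Rightarrow> real) \<Rightarrow>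
   ('a \<times> 'e \<Rightarrow> real) \<Rightarrow> ('a \<times> 'e \<Rightarrow> real) \<Rightarrow> 'a \<times> 'e \<Rightarrow> real" where
  "poisson_bracket N g f h z =
     symplectic_form N g z (hamiltonian_field N g f z) (hamiltonian_field N g h z)"

lemma lie_inner_bilinear:
  assumes "is_lie_group N" "left_invariant_metric N g"
  shows "bilinear (lie_inner N g)"
proof -
  interpret group N using assms(1) by (simp add: is_lie_group_def)
  show ?thesis
    using assms one_closed
    by (simp add: is_lie_group_def left_invariant_metric_def riemannian_metric_def lie_inner_def)
qed

lemma symplectic_form_explicit:
  assumes "is_lie_group N" "left_invariant_metric N g"
  shows "symplectic_form N g (p, Y) (U, V) (U', V') =
    lie_inner N g U V' - lie_inner N g V U' + lie_inner N g Y (lie_bracket N U U')"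
proof -
  have b: "bilinear (lie_inner N g)" by (rule lie_inner_bilinear[OF assms])
  have "lie_inner N g U V' = lie_inner N g V' U"
    using assms group.is_monoid[THEN monoid.one_closed, of N]
    by (auto simp: is_lie_group_def left_invariant_metric_def riemannian_metric_def lie_inner_def)
  moreover have "deriv (\<lambda>t. lie_inner N g (Y + t *\<^sub>R A) B) 0 = lie_inner N g A B" for A B
    by (rule DERIV_imp_deriv)
      (auto simp: bilinear_ladd[OF b] bilinear_lmul[OF b] intro!: derivative_eq_intros)
  ultimately show ?thesis
    by (simp add: symplectic_form_def ext_deriv_def differential_def canonical_form_def)
qed

end

theory Submission
  imports Defs
begin

text \<open>
  The explicit form of \<open>\<Omega>\<close> makes the lemma linear algebra, provided that \<open>ad(V)\<close> is linear, so that
  its transpose exists. In the chart \<open>c\<close> around the identity, with \<open>m\<close> the multiplication in the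
  coordinates of \<open>c\<close>, the left-invariant field of \<open>U\<close> is \<open>x \<mapsto> Dm(x, c(1))(0, U)\<close>; it is differentiable
  in \<open>x\<close> and linear in \<open>U\<close>, and linearity of the bracket follows.
\<close>

section \<open>Charts of a smooth manifold\<close>

lemma smooth_on_open_differentiable:
  assumes "smooth_on S F" "open S" "x \<in> S"
  shows "F differentiable at x" "(\<lambda>y. frechet_derivative F (at y) v) differentiable at x"
proof -
  \<comment> \<open>Order two covers both claims: one derivative for \<open>F\<close>, one more for
    its directional derivatives. Openness of \<open>S\<close> turns differentiability within
    \<open>S\<close> into differentiability at \<open>x\<close>.\<close>
  have "Ck_on (Suc (Suc 0)) F S"
    using assms(1) unfolding smooth_on_def by blast
  then show "F differentiable at x" "(\<lambda>y. frechet_derivative F (at y) v) differentiable at x"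
    using assms(2,3) by (auto simp: differentiable_on_eq_differentiable_at)
qed

lemma chart_inj_on:
  assumes "smooth_manifold M" "c \<in> snd M"
  shows "inj_on (snd c) (fst c)"
proof -
  have o: "openin (fst M) (fst c)" and
    h: "homeomorphic_map (subtopology (fst M) (fst c)) (top_of_set (snd c ` fst c)) (snd c)"
    using assms by (auto simp: smooth_manifold_def)
  have "topspace (subtopology (fst M) (fst c)) = fst c"
    using openin_subset[OF o] by auto
  with homeomorphic_imp_injective_map[OF h] show ?thesis by simp
qed

lemma chart_inv_chart:
  assumes "smooth_manifold M" "c \<in> snd M" "p \<in> fst c"
  shows "chart_inv c (snd c p) = p"
  unfolding chart_inv_def by (rule inv_into_f_f[OF chart_inj_on[OF assms(1,2)] assms(3)])

lemma open_chart_image: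
  assumes "smooth_manifold M" "c \<in> snd M" "openin (fst M) W" "W \<subseteq> fst c"
  shows "open (snd c ` W)"
proof -
  have o: "openin (fst M) (fst c)" "open (snd c ` fst c)" and
    h: "homeomorphic_map (subtopology (fst M) (fst c)) (top_of_set (snd c ` fst c)) (snd c)"
    using assms(1,2) by (auto simp: smooth_manifold_def)
  have "openin (subtopology (fst M) (fst c)) W"
    using assms(3,4) o(1) by (simp add: openin_open_subtopology)
  then have "openin (top_of_set (snd c ` fst c)) (snd c ` W)"
    using homeomorphic_imp_open_map[OF h] by (simp add: open_map_def)
  then show ?thesis using o(2) by (rule openin_open_trans)
qed

text \<open>Each point of \<open>W\<close> lies in an open box contained in \<open>W\<close>, and a
  product chart sends a box to the product of two open chart images.\<close>

lemma open_prod_chart_image: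
  assumes "smooth_manifold M" "c \<in> snd M" "smooth_manifold M'" "d \<in> snd M'"
    and W: "openin (prod_topology (fst M) (fst M')) W" "W \<subseteq> fst c \<times> fst d"
  shows "open (map_prod (snd c) (snd d) ` W)"
proof (rule Topological_Spaces.openI)
  fix z assume "z \<in> map_prod (snd c) (snd d) ` W"
  then obtain p q where pq: "(p, q) \<in> W" "z = (snd c p, snd d q)" by auto
  obtain A B where AB: "openin (fst M) A" "openin (fst M') B" "p \<in> A" "q \<in> B" "A \<times> B \<subseteq> W"
    using W(1) pq(1) unfolding openin_prod_topology_alt by meson
  have "A \<subseteq> fst c" "B \<subseteq> fst d" using AB W(2) by blast+
  then have "open (snd c ` A \<times> snd d ` B)"
    using AB assms by (intro open_Times open_chart_image) auto
  moreover have "snd c ` A \<times> snd d ` B \<subseteq> map_prod (snd c) (snd d) ` W"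
    using AB(5) by force
  ultimately show "\<exists>T. open T \<and> z \<in> T \<and> T \<subseteq> map_prod (snd c) (snd d) ` W"
    using AB(3,4) pq(2) by blast
qed

lemma chart_at_in:
  assumes "smooth_manifold M" "p \<in> topspace (fst M)"
  shows "chart_at M p \<in> snd M" "p \<in> fst (chart_at M p)"
proof -
  have "\<exists>c. c \<in> snd M \<and> p \<in> fst c"
    using assms unfolding smooth_manifold_def by blast
  from someI_ex[OF this] show "chart_at M p \<in> snd M" "p \<in> fst (chart_at M p)"
    unfolding chart_at_def by auto
qed

lemma transition_differentiable:
  assumes M: "smooth_manifold M" and "c \<in> snd M" "d \<in> snd M" "p \<in> fst c" "p \<in> fst d"
  shows "(snd d \<circ> chart_inv c) differentiable at (snd c p)"
proof (rule smooth_on_open_differentiable(1))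
  show "smooth_on (snd c ` (fst c \<inter> fst d)) (snd d \<circ> chart_inv c)"
    using assms by (simp add: smooth_manifold_def)
  show "open (snd c ` (fst c \<inter> fst d))"
    using assms by (intro open_chart_image[OF M]) (auto simp: smooth_manifold_def)
qed (use assms in auto)

section \<open>The group multiplication in coordinates\<close>

text \<open>The product chart is kept whole inside \<open>chart_inv\<close>, so that this map and
  \<open>mult_domain\<close> are literally the map and the set in the \<open>smooth_map\<close>
  condition for the multiplication.\<close>

definition mult_in_charts ::
  "('a, 'e::euclidean_space) lie_group \<Rightarrow> ('a, 'e) chart \<Rightarrow> ('a, 'e) chart \<Rightarrow> ('a, 'e) chart \<Rightarrow>
   'e \<times> 'e \<Rightarrow> 'e" where
  "mult_in_charts N c d e =
     snd e \<circ> (\<lambda>(p, q). p \<otimes>\<^bsub>N\<^esub> q) \<circ> chart_inv (fst c \<times> fst d, map_prod (snd c) (snd d))"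

definition mult_domain ::
  "('a, 'e::euclidean_space) lie_group \<Rightarrow> ('a, 'e) chart \<Rightarrow> ('a, 'e) chart \<Rightarrow> ('a, 'e) chart \<Rightarrow>
   ('e \<times> 'e) set" where
  "mult_domain N c d e =
     map_prod (snd c) (snd d) ` ((fst c \<times> fst d) \<inter> (\<lambda>(p, q). p \<otimes>\<^bsub>N\<^esub> q) -` fst e)"

context
  fixes N :: "('a, 'e::euclidean_space) lie_group"
  assumes N: "is_lie_group N"
begin

interpretation group N
  using N by (simp add: is_lie_group_def)

lemma mfd_smooth: "smooth_manifold (mfd N)"
  using N by (simp add: is_lie_group_def)

lemma topspace_mfd: "topspace (fst (mfd N)) = carrier N"
  using N by (simp add: is_lie_group_def)

lemma chart_subset_carrier: "c \<in> snd (mfd N) \<Longrightarrow> fst c \<subseteq> carrier N"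
  using mfd_smooth topspace_mfd unfolding smooth_manifold_def by (metis openin_subset)

lemma mult_in_charts_eq:
  assumes "c \<in> snd (mfd N)" "d \<in> snd (mfd N)" "p \<in> fst c" "q \<in> fst d"
  shows "mult_in_charts N c d e (snd c p, snd d q) = snd e (p \<otimes>\<^bsub>N\<^esub> q)"
proof -
  have "inj_on (map_prod (snd c) (snd d)) (fst c \<times> fst d)"
    using assms chart_inj_on[OF mfd_smooth] by (intro map_prod_inj_on) auto
  from inv_into_f_f[OF this, of "(p, q)"] show ?thesis
    using assms by (simp add: mult_in_charts_def chart_inv_def)
qed

lemma smooth_on_mult_in_charts:
  assumes "c \<in> snd (mfd N)" "d \<in> snd (mfd N)" "e \<in> snd (mfd N)"
  shows "smooth_on (mult_domain N c d e) (mult_in_charts N c d e)"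
proof -
  have "(fst c \<times> fst d, map_prod (snd c) (snd d)) \<in> snd (prod_manifold (mfd N) (mfd N))"
    using assms unfolding prod_manifold_def snd_conv by blast
  moreover have "smooth_map (prod_manifold (mfd N) (mfd N)) (mfd N) (\<lambda>(p, q). p \<otimes>\<^bsub>N\<^esub> q)"
    using N by (simp add: is_lie_group_def)
  ultimately show ?thesis
    using assms(3) unfolding smooth_map_def mult_domain_def mult_in_charts_def by fastforce
qed

lemma open_mult_domain:
  assumes "c \<in> snd (mfd N)" "d \<in> snd (mfd N)" "e \<in> snd (mfd N)"
  shows "open (mult_domain N c d e)"
  unfolding mult_domain_def
proof (rule open_prod_chart_image[OF mfd_smooth assms(1) mfd_smooth assms(2)])
  let ?T = "prod_topology (fst (mfd N)) (fst (mfd N))" and ?m = "\<lambda>(p, q). p \<otimes>\<^bsub>N\<^esub> q"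
  have o: "openin (fst (mfd N)) (fst c)" "openin (fst (mfd N)) (fst d)" "openin (fst (mfd N)) (fst e)"
    using assms mfd_smooth by (auto simp: smooth_manifold_def)
  have m: "continuous_map ?T (fst (mfd N)) ?m"
    using N by (simp add: is_lie_group_def smooth_map_def prod_manifold_def)
  have "openin ?T ((fst c \<times> fst d) \<inter> {z \<in> topspace ?T. ?m z \<in> fst e})"
    using o by (intro openin_Int openin_continuous_map_preimage[OF m]) (auto simp: openin_prod_Times_iff)
  also have "(fst c \<times> fst d) \<inter> {z \<in> topspace ?T. ?m z \<in> fst e} = (fst c \<times> fst d) \<inter> ?m -` fst e"
    using assms(1,2)[THEN chart_subset_carrier] by (auto simp: topspace_mfd)
  finally show "openin ?T ((fst c \<times> fst d) \<inter> ?m -` fst e)" .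
qed auto

text \<open>Membership only provides some point with the same coordinates as \<open>p\<close>;
  injectivity of the chart identifies it with \<open>p\<close>.\<close>

lemma mult_domainD:
  assumes "c \<in> snd (mfd N)" "p \<in> fst c" "(snd c p, y) \<in> mult_domain N c d e"
  obtains q where "q \<in> fst d" "y = snd d q" "p \<otimes>\<^bsub>N\<^esub> q \<in> fst e"
proof -
  obtain p' q where "p' \<in> fst c" "q \<in> fst d" "p' \<otimes>\<^bsub>N\<^esub> q \<in> fst e" "snd c p = snd c p'" "y = snd d q"
    using assms(3) unfolding mult_domain_def by auto
  moreover have "p' = p"
    using calculation assms chart_inj_on[OF mfd_smooth assms(1)] by (auto dest: inj_onD)
  ultimately show ?thesis using that by blast
qed

lemma mult_domainI:
  assumes "p \<in> fst c" "q \<in> fst d" "p \<otimes>\<^bsub>N\<^esub> q \<in> fst e"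
  shows "(snd c p, snd d q) \<in> mult_domain N c d e"
  using assms unfolding mult_domain_def by force

lemma open_mult_domain_slice:
  assumes "c \<in> snd (mfd N)" "d \<in> snd (mfd N)" "e \<in> snd (mfd N)"
  shows "open {y. (x, y) \<in> mult_domain N c d e}"
  using open_vimage[OF open_mult_domain[OF assms], of "Pair x"]
  by (simp add: vimage_def continuous_on_Pair continuous_on_const continuous_on_id)

section \<open>Left translations and left-invariant fields in coordinates\<close>

text \<open>Left translation by \<open>p\<close> is the multiplication restricted to the slice
  \<open>y \<mapsto> (snd c p, y)\<close>, so the chain rule gives its derivative as a partial
  derivative of the multiplication. The two coordinate formulas agree on the open slice of
  \<open>mult_domain\<close>.\<close>

lemma left_translation_has_derivative:
  assumes "c \<in> snd (mfd N)" "d \<in> snd (mfd N)" "e \<in> snd (mfd N)"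
    and "p \<in> fst c" "q \<in> fst d" "p \<otimes>\<^bsub>N\<^esub> q \<in> fst e"
  shows "((snd e \<circ> (\<lambda>r. p \<otimes>\<^bsub>N\<^esub> r) \<circ> chart_inv d) has_derivative
    (\<lambda>v. frechet_derivative (mult_in_charts N c d e) (at (snd c p, snd d q)) (0, v))) (at (snd d q))"
proof (rule has_derivative_transform_within_open)
  let ?S = "{y. (snd c p, y) \<in> mult_domain N c d e}"
  let ?D = "frechet_derivative (mult_in_charts N c d e) (at (snd c p, snd d q))"
  have "mult_in_charts N c d e differentiable at (snd c p, snd d q)"
    by (rule smooth_on_open_differentiable(1)[OF smooth_on_mult_in_charts[OF assms(1-3)]
          open_mult_domain[OF assms(1-3)] mult_domainI[OF assms(4-6)]])
  then have "(mult_in_charts N c d e has_derivative ?D) (at (snd c p, snd d q))"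
    by (simp add: frechet_derivative_works)
  moreover have "((\<lambda>y. (snd c p, y)) has_derivative (\<lambda>v. (0, v))) (at (snd d q))"
    by (auto intro!: derivative_eq_intros)
  ultimately show
    "((\<lambda>y. mult_in_charts N c d e (snd c p, y)) has_derivative (\<lambda>v. ?D (0, v))) (at (snd d q))"
    by (rule has_derivative_compose[rotated])
  show "open ?S" by (rule open_mult_domain_slice[OF assms(1-3)])
  show "snd d q \<in> ?S" using mult_domainI[OF assms(4-6)] by simp
  fix y assume "y \<in> ?S"
  then obtain r where "r \<in> fst d" "y = snd d r" using mult_domainD assms(1,4) by blast
  then show "mult_in_charts N c d e (snd c p, y) = (snd e \<circ> (\<lambda>r. p \<otimes>\<^bsub>N\<^esub> r) \<circ> chart_inv d) y"
    using assms by (simp add: mult_in_charts_eq chart_inv_chart[OF mfd_smooth])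
qed

text \<open>By definition the field at \<open>p\<close> is expressed in the preferred chart at
  \<open>p\<close>, which may vary with \<open>p\<close> without any continuity. Converting to the
  fixed chart \<open>c\<close> cancels that chart, and what remains depends on \<open>p\<close> only
  through the coordinates at which a derivative of the multiplication is taken. This makes the field
  visibly differentiable, and linear in \<open>U\<close>.\<close>

lemma left_invariant_field_in_chart:
  defines "c \<equiv> chart_at (mfd N) \<one>\<^bsub>N\<^esub>"
  assumes p: "p \<in> fst c"
  shows "field_in_chart (mfd N) c (left_invariant_field N U) (snd c p) =
    frechet_derivative (mult_in_charts N c c c) (at (snd c p, snd c \<one>\<^bsub>N\<^esub>)) (0, U)"
proof -
  define d where "d = chart_at (mfd N) p"
  have c: "c \<in> snd (mfd N)" "\<one>\<^bsub>N\<^esub> \<in> fst c"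
    unfolding c_def by (auto intro!: chart_at_in mfd_smooth simp: topspace_mfd)
  have pN: "p \<in> carrier N" using p c chart_subset_carrier by blast
  have d: "d \<in> snd (mfd N)" "p \<in> fst d"
    unfolding d_def using pN by (auto intro!: chart_at_in mfd_smooth simp: topspace_mfd)
  have p1: "p \<otimes>\<^bsub>N\<^esub> \<one>\<^bsub>N\<^esub> = p" using pN by simp
  let ?T = "snd d \<circ> (\<lambda>r. p \<otimes>\<^bsub>N\<^esub> r) \<circ> chart_inv c"
  let ?A = "frechet_derivative ?T (at (snd c \<one>\<^bsub>N\<^esub>))"
  let ?B = "frechet_derivative (snd c \<circ> chart_inv d) (at (snd d p))"
  have A: "(?T has_derivative ?A) (at (snd c \<one>\<^bsub>N\<^esub>))"
    using left_translation_has_derivative[OF d(1) c(1) d(1) d(2) c(2)] d(2) p1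
    by (metis differentiableI frechet_derivative_works)
  have B: "((snd c \<circ> chart_inv d) has_derivative ?B) (at (snd d p))"
    using transition_differentiable[OF mfd_smooth d(1) c(1) d(2) p]
    by (simp add: frechet_derivative_works)
  \<comment> \<open>Since \<open>p\<close> times the identity is \<open>p\<close>, the inner map
    ends exactly at the base point of the derivative \<open>?B\<close>.\<close>
  have "?T (snd c \<one>\<^bsub>N\<^esub>) = snd d p"
    using c p1 by (simp add: chart_inv_chart[OF mfd_smooth])
  then have "((snd c \<circ> chart_inv d) has_derivative ?B) (at (?T (snd c \<one>\<^bsub>N\<^esub>)))"
    using B by metis
  \<comment> \<open>Near the identity, as long as the product with \<open>p\<close> stays in the
    domain of \<open>d\<close>, the factors through \<open>d\<close> cancel and left translation is
    read in \<open>c\<close> on both sides.\<close>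
  from has_derivative_compose[OF A this] have "((snd c \<circ> (\<lambda>r. p \<otimes>\<^bsub>N\<^esub> r) \<circ> chart_inv c) has_derivative (\<lambda>v. ?B (?A v))) (at (snd c \<one>\<^bsub>N\<^esub>))"
  proof (rule has_derivative_transform_within_open)
    let ?S = "{y. (snd d p, y) \<in> mult_domain N d c d}"
    show "open ?S" by (rule open_mult_domain_slice[OF d(1) c(1) d(1)])
    show "snd c \<one>\<^bsub>N\<^esub> \<in> ?S" using mult_domainI d c p1 by simp
    fix y assume "y \<in> ?S"
    then obtain r where "r \<in> fst c" "y = snd c r" "p \<otimes>\<^bsub>N\<^esub> r \<in> fst d" using mult_domainD d by blast
    then show "(snd c \<circ> chart_inv d) (?T y) = (snd c \<circ> (\<lambda>r. p \<otimes>\<^bsub>N\<^esub> r) \<circ> chart_inv c) y"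
      using c d by (simp add: chart_inv_chart[OF mfd_smooth])
  qed
  moreover have "((snd c \<circ> (\<lambda>r. p \<otimes>\<^bsub>N\<^esub> r) \<circ> chart_inv c) has_derivative
    (\<lambda>v. frechet_derivative (mult_in_charts N c c c) (at (snd c p, snd c \<one>\<^bsub>N\<^esub>)) (0, v))) (at (snd c \<one>\<^bsub>N\<^esub>))"
    using left_translation_has_derivative[OF c(1) c(1) c(1) p c(2)] p p1 by simp
  \<comment> \<open>The same map has now been differentiated in two ways: through \<open>d\<close>,
    and as a slice of the multiplication in \<open>c\<close>.\<close>
  ultimately have "(\<lambda>v. ?B (?A v)) =
    (\<lambda>v. frechet_derivative (mult_in_charts N c c c) (at (snd c p, snd c \<one>\<^bsub>N\<^esub>)) (0, v))"
    by (rule has_derivative_unique)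
  moreover have "field_in_chart (mfd N) c (left_invariant_field N U) (snd c p) = ?B (?A U)"
    using c p pN
    by (simp add: field_in_chart_def chart_inv_chart[OF mfd_smooth] to_chart_def
        left_invariant_field_def dL_def tangent_map_def flip: d_def c_def)
  ultimately show ?thesis by metis
qed

section \<open>Linearity of \<open>ad\<close>\<close>

text \<open>In \<open>c\<close> the bracket consists of the derivative of \<open>F U\<close> applied
  to \<open>F V x\<close> and the derivative of \<open>F V\<close> applied to \<open>F U x\<close>.
  The second is linear in \<open>U\<close> because \<open>F U x\<close> is; the first because
  \<open>F U y\<close> is linear in \<open>U\<close> for all \<open>y\<close> near \<open>x\<close>,
  so that the derivatives depend linearly on \<open>U\<close> as well.\<close>

lemma linear_lie_bracket: "linear (lie_bracket N V)"
proof -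
  define c where "c = chart_at (mfd N) \<one>\<^bsub>N\<^esub>"
  define x where "x = snd c \<one>\<^bsub>N\<^esub>"
  define m where "m = mult_in_charts N c c c"
  define F where "F = (\<lambda>U. field_in_chart (mfd N) c (left_invariant_field N U))"
  have c: "c \<in> snd (mfd N)" "\<one>\<^bsub>N\<^esub> \<in> fst c"
    unfolding c_def by (auto intro!: chart_at_in mfd_smooth simp: topspace_mfd)
  have pN: "p \<in> carrier N" if "p \<in> fst c" for p using that c chart_subset_carrier by blast
  have opn: "open (snd c ` fst c)" and x: "x \<in> snd c ` fst c"
    using c mfd_smooth by (auto simp: smooth_manifold_def x_def)
  have F: "F U y = frechet_derivative m (at (y, x)) (0, U)" if "y \<in> snd c ` fst c" for U y
    using that left_invariant_field_in_chart by (auto simp: F_def m_def c_def x_def)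
  have dom: "(y, x) \<in> mult_domain N c c c" if "y \<in> snd c ` fst c" for y
    using that c pN unfolding x_def by (auto intro!: mult_domainI)
  note m_diff = smooth_on_open_differentiable[OF smooth_on_mult_in_charts[OF c(1) c(1) c(1)]
      open_mult_domain[OF c(1) c(1) c(1)] dom, folded m_def]
  have lin: "linear (\<lambda>U. F U y)" if y: "y \<in> snd c ` fst c" for y
  proof -
    have "linear (\<lambda>U. frechet_derivative m (at (y, x)) (0, U))"
      using linear_compose[OF _ linear_frechet_derivative[OF m_diff(1)[OF y]], of "Pair 0"]
      by (simp add: o_def linear_iff)
    then show ?thesis by (simp add: F[OF y])
  qed
  \<comment> \<open>\<open>frechet_derivative\<close> is informative only where a derivative exists.
    Here it comes from the second order smoothness of the multiplication, restricted to the line of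
    points \<open>(y, x)\<close>.\<close>
  have F_der: "(F U has_derivative frechet_derivative (F U) (at x)) (at x)" for U
  proof -
    have "(\<lambda>z. frechet_derivative m (at z) (0, U)) differentiable at (x, x)"
      by (rule m_diff(2)[OF x])
    then obtain D where D: "((\<lambda>z. frechet_derivative m (at z) (0, U)) has_derivative D) (at (x, x))"
      unfolding differentiable_def by blast
    have "((\<lambda>y. (y, x)) has_derivative (\<lambda>v. (v, 0))) (at x)"
      by (auto intro!: derivative_eq_intros)
    from has_derivative_compose[OF this D]
    have "(F U has_derivative (\<lambda>v. D (v, 0))) (at x)"
      by (rule has_derivative_transform_within_open[OF _ opn x]) (simp add: F)
    then show ?thesis by (metis differentiableI frechet_derivative_works)
  qed
  have br: "lie_bracket N V U =
    frechet_derivative (F U) (at x) (F V x) - frechet_derivative (F V) (at x) (F U x)" for U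
    by (simp add: lie_bracket_def field_bracket_def Let_def F_def c_def x_def)
  have linV: "linear (frechet_derivative (F V) (at x))"
    using F_der by (rule has_derivative_linear)
  \<comment> \<open>Additivity of the fields holds on the whole open chart image, hence passes to
    the derivatives at \<open>x\<close>; likewise for scalars.\<close>
  have add: "frechet_derivative (F (U + W)) (at x) =
    (\<lambda>v. frechet_derivative (F U) (at x) v + frechet_derivative (F W) (at x) v)" for U W
  proof (rule has_derivative_unique[OF F_der])
    show "(F (U + W) has_derivative
      (\<lambda>v. frechet_derivative (F U) (at x) v + frechet_derivative (F W) (at x) v)) (at x)"
      by (rule has_derivative_transform_within_open[OF has_derivative_add[OF F_der F_der] opn x])
        (simp add: linear_add[OF lin])
  qed
  have scale: "frechet_derivative (F (r *\<^sub>R U)) (at x) =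
    (\<lambda>v. r *\<^sub>R frechet_derivative (F U) (at x) v)" for r U
  proof (rule has_derivative_unique[OF F_der])
    show "(F (r *\<^sub>R U) has_derivative (\<lambda>v. r *\<^sub>R frechet_derivative (F U) (at x) v)) (at x)"
      by (rule has_derivative_transform_within_open[OF has_derivative_scaleR_right[OF F_der] opn x])
        (simp add: linear_scale[OF lin])
  qed
  show ?thesis
  proof (rule linearI)
    show "lie_bracket N V (U + W) = lie_bracket N V U + lie_bracket N V W" for U W
      by (simp add: br add linear_add[OF lin[OF x]] linear_add[OF linV])
    show "lie_bracket N V (r *\<^sub>R U) = r *\<^sub>R lie_bracket N V U" for r U
      by (simp add: br scale linear_scale[OF lin[OF x]] linear_scale[OF linV] scaleR_diff_right)
  qed
qed

end

lemma lie_bracket_anticomm: "lie_bracket N U V = - lie_bracket N V U"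
  by (simp add: lie_bracket_def field_bracket_def Let_def)

section \<open>Transposes with respect to an inner product\<close>

text \<open>The map \<open>T\<close> expresses \<open>h\<close> through the Euclidean inner product
  of the type. Positivity makes \<open>T\<close> injective, and finite dimension makes it
  surjective; \<open>z\<close> is the preimage of the Euclidean representative of
  \<open>\<phi>\<close>.\<close>

lemma riesz_bilinear:
  fixes h :: "'e::euclidean_space \<Rightarrow> 'e \<Rightarrow> real"
  assumes h: "bilinear h" and pos: "\<And>u. u \<noteq> 0 \<Longrightarrow> h u u > 0" and \<phi>: "linear \<phi>"
  shows "\<exists>z. \<forall>x. \<phi> x = h z x"
proof -
  define T where "T x = (\<Sum>b\<in>Basis. h x b *\<^sub>R b)" for x
  \<comment> \<open>A linear functional is the Euclidean inner product with the vector of its values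
    on the basis.\<close>
  have rep: "\<psi> y = (\<Sum>b\<in>Basis. \<psi> b *\<^sub>R b) \<bullet> y" if "linear \<psi>" for \<psi> :: "'e \<Rightarrow> real" and y
    by (subst Linear_Algebra.linear_componentwise[OF that, of y 1, simplified])
      (simp add: inner_sum_left inner_commute[of y] mult.commute)
  have hT: "h x y = T x \<bullet> y" for x y
    unfolding T_def using h by (intro rep) (simp add: bilinear_def)
  have "linear T"
    unfolding T_def by (rule linearI)
      (simp_all add: bilinear_ladd[OF h] bilinear_lmul[OF h] scaleR_add_left sum.distrib scaleR_sum_right)
  moreover have "inj T"
    unfolding linear_injective_0[OF \<open>linear T\<close>]
    by (metis hT inner_zero_left less_irrefl pos)
  ultimately have "surj T" by (rule linear_injective_imp_surjective) simp
  then obtain z where "T z = (\<Sum>b\<in>Basis. \<phi> b *\<^sub>R b)" by (metis surjD)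
  with rep[OF \<phi>] hT show ?thesis by metis
qed

text \<open>The \<open>SOME\<close> in the definition needs a witness: for each \<open>y\<close>,
  Riesz represents \<open>x \<mapsto> h (L x) y\<close>, and choice collects these vectors into a
  map.\<close>

lemma transpose_wrt:
  fixes h :: "'e::euclidean_space \<Rightarrow> 'e \<Rightarrow> real"
  assumes "bilinear h" "\<And>u v. h u v = h v u" "\<And>u. u \<noteq> 0 \<Longrightarrow> h u u > 0" "linear L"
  shows "h (L x) y = h x (transpose_wrt h L y)"
proof -
  have "\<exists>z. \<forall>x. h (L x) y = h x z" for y
  proof -
    have "linear (\<lambda>x. h (L x) y)"
      using linear_compose[OF assms(4), of "\<lambda>x. h x y"] assms(1)
      by (simp add: bilinear_def o_def)
    from riesz_bilinear[OF assms(1,3) this] show ?thesis using assms(2) by metis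
  qed
  then have "\<exists>L'. \<forall>x y. h (L x) y = h x (L' y)" by metis
  from someI_ex[OF this] show ?thesis unfolding transpose_wrt_def by blast
qed

lemma lie_inner_sym_pos:
  assumes "is_lie_group N" "left_invariant_metric N g"
  shows "lie_inner N g u v = lie_inner N g v u" "u \<noteq> 0 \<Longrightarrow> lie_inner N g u u > 0"
  using assms group.is_monoid[THEN monoid.one_closed, of N]
  by (auto simp: is_lie_group_def left_invariant_metric_def riemannian_metric_def lie_inner_def)

lemma ad_transpose:
  assumes "is_lie_group N" "left_invariant_metric N g"
  shows "lie_inner N g (lie_bracket N V X) Y = lie_inner N g X (ad_transpose N g V Y)"
proof -
  have "ad N V = lie_bracket N V" by (simp add: fun_eq_iff ad_def)
  then show ?thesis
    unfolding ad_transpose_def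
    using transpose_wrt[OF lie_inner_bilinear[OF assms] lie_inner_sym_pos[OF assms]
        linear_lie_bracket[OF assms(1)], of V X Y]
    by simp
qed

section \<open>The Hamiltonian field and the Poisson bracket\<close>

text \<open>Substitution into the explicit form of the symplectic form gives existence: the
  transpose term cancels the bracket term. Testing the defining equation on \<open>(0, w)\<close>
  and \<open>(w, 0)\<close> determines the two components one after the other.\<close>

lemma hamiltonian_field_eq:
  assumes N: "is_lie_group N" "left_invariant_metric N g"
    and grad: "has_gradient N g f (p, Y) (U, V)"
  shows "hamiltonian_field N g f (p, Y) = (V, ad_transpose N g V Y - U)"
proof -
  let ?h = "lie_inner N g"
  note b = lie_inner_bilinear[OF N]
  note sym = lie_inner_sym_pos(1)[OF N]
  note \<Omega> = symplectic_form_explicit[OF N]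
  \<comment> \<open>Positivity is applied with \<open>w\<close> equal to
    \<open>x - y\<close>.\<close>
  have nondeg: "x = y" if "\<And>w. ?h x w = ?h y w" for x y
    using that lie_inner_sym_pos(2)[OF N, of "x - y"] by (force simp: bilinear_lsub[OF b])
  have df: "differential N f (p, Y) (U', V') = ?h U U' + ?h V V'" for U' V'
    using grad by (simp add: has_gradient_def TN_metric_def)
  have ad: "?h (ad_transpose N g V Y) w = ?h Y (lie_bracket N V w)" for w
    using ad_transpose[OF N, of V w Y] sym by metis
  show ?thesis
    unfolding hamiltonian_field_def
  proof (rule the_equality)
    show "\<forall>\<xi>. differential N f (p, Y) \<xi> = symplectic_form N g (p, Y) (V, ad_transpose N g V Y - U) \<xi>"
      by (auto simp: df \<Omega> bilinear_lsub[OF b] ad)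
  next
    fix X assume X: "\<forall>\<xi>. differential N f (p, Y) \<xi> = symplectic_form N g (p, Y) X \<xi>"
    obtain A B where AB: "X = (A, B)" by fastforce
    have eq: "?h U U' + ?h V V' = ?h A V' - ?h B U' + ?h Y (lie_bracket N A U')" for U' V'
      using X df[of U' V'] by (simp add: AB \<Omega>)
    \<comment> \<open>The test vector \<open>(0, w)\<close> removes the bracket term, because the
      bracket with 0 vanishes by linearity.\<close>
    have "?h V w = ?h A w" for w
      using eq[of 0 w] linear_0[OF linear_lie_bracket[OF N(1)]] by (simp add: bilinear_rzero[OF b])
    then have "V = A" by (rule nondeg)
    moreover have "B = ad_transpose N g V Y - U"
    proof (rule nondeg)
      show "?h B w = ?h (ad_transpose N g V Y - U) w" for w
        using eq[of w 0, folded \<open>V = A\<close>] by (simp add: bilinear_rzero[OF b] bilinear_lsub[OF b] ad)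
    qed
    ultimately show "X = (V, ad_transpose N g V Y - U)" by (simp add: AB)
  qed
qed

theorem lemma2p3:
  fixes N :: "('a, 'e::euclidean_space) lie_group"
    and g :: "'a \<Rightarrow> 'e \<Rightarrow> 'e \<Rightarrow> real"
    and f :: "'a \<times> 'e \<Rightarrow> real"
    and p :: 'a and Y U V :: 'e
  assumes "is_lie_group N"
    and "left_invariant_metric N g"
    and "smooth_on_TN N f"
    and "p \<in> carrier N"
    and "has_gradient N g f (p, Y) (U, V)"
  shows "hamiltonian_field N g f (p, Y) = (V, ad_transpose N g V Y - U) \<and>
    (\<forall>h U' V'. smooth_on_TN N h \<longrightarrow> has_gradient N g h (p, Y) (U', V') \<longrightarrow>
       poisson_bracket N g f h (p, Y) =
         - symplectic_form N g (p, Y) (prod.swap (U, V)) (prod.swap (U', V')) \<and>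
       - symplectic_form N g (p, Y) (prod.swap (U, V)) (prod.swap (U', V')) =
         lie_inner N g V' U - lie_inner N g V U' - lie_inner N g Y (lie_bracket N V V'))"
proof (intro conjI allI impI)
  note b = lie_inner_bilinear[OF assms(1,2)]
  note sym = lie_inner_sym_pos(1)[OF assms(1,2)]
  note \<Omega> = symplectic_form_explicit[OF assms(1,2)]
  note X = hamiltonian_field_eq[OF assms(1,2)]
  show "hamiltonian_field N g f (p, Y) = (V, ad_transpose N g V Y - U)"
    by (rule X[OF assms(5)])
  fix h U' V' assume h: "has_gradient N g h (p, Y) (U', V')"
  show swap: "- symplectic_form N g (p, Y) (prod.swap (U, V)) (prod.swap (U', V')) =
    lie_inner N g V' U - lie_inner N g V U' - lie_inner N g Y (lie_bracket N V V')"
    by (simp add: \<Omega> sym[of U])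
  \<comment> \<open>The pairing of \<open>Y\<close> with \<open>[V, V']\<close> enters the Poisson
    bracket three times: each transpose term contributes it with sign minus (the one from
    \<open>X_h\<close> by anticommutativity), the explicit bracket term with sign plus. The total is
    one copy with sign minus.\<close>
  have "lie_inner N g V (ad_transpose N g V' Y) = - lie_inner N g Y (lie_bracket N V V')"
    using ad_transpose[OF assms(1,2), of V' V Y] lie_bracket_anticomm[of N V' V] sym
    by (simp add: bilinear_rneg[OF b])
  moreover have "lie_inner N g (ad_transpose N g V Y) V' = lie_inner N g Y (lie_bracket N V V')"
    using ad_transpose[OF assms(1,2), of V V' Y] sym by metis
  ultimately show "poisson_bracket N g f h (p, Y) =
      - symplectic_form N g (p, Y) (prod.swap (U, V)) (prod.swap (U', V'))"
    unfolding swap poisson_bracket_def X[OF assms(5)] X[OF h] \<Omega>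
    by (simp add: bilinear_lsub[OF b] bilinear_rsub[OF b] sym[of U])
qed

end
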